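(* Let $n\in\mathbb N=\{1,2,\ldots\}$, let $F$ be a subfield of $\mathbb R$, and let $T$ be a subring of $F$ such that $\mathbb Z\subseteq T\cap\mathbb Q$ and $\mathbb Z\neq T\cap\mathbb Q$. Let $C$ and $C'$ be $F$-convex subsets (equivalently, geometric convex subsets) of $F^n$. Assume also that (a) $F=\mathbb Q$, or (b) $C$ and $C'$ have the same affine $F$-dimension and at least one of them is bounded. Then the following three conditions are equivalent. (i) $(C,\underline{I}^{o}(T))$ and $(C',\underline{I}^{o}(T))$ are isomorphic $T$-barycentric algebras, i.e. there is a bijection $\varphi\colon C\to C'$ such that $\varphi((1-p)x+py)=(1-p)\varphi(x)+p\,\varphi(y)$ for all $x,y\in C$ and all $p\in T$ with $0<p<1$. (ii) The affine $F$-space $F^n$ has an automorphism $\psi$ such that $\psi(C)=C'$. (iii) The affine real space $\mathbb R^n$ has an automorphism $\psi$ such that $\psi(C)=C'$.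
   Context: For a subring $S$ of $\mathbb R$ containing $1$, let $I^{o}(S)=\{p\in S: 0<p<1\}$. For $p\in\mathbb R$ let $\underline p$ be the binary operation $(x,y)\mapsto (1-p)x+py$ on $\mathbb R^n$, and let $\underline{I}^{o}(S)=\{\underline p: p\in I^{o}(S)\}$. An $S$-convex subset of $\mathbb R^n$ is a nonempty subset closed under all operations in $\underline{I}^{o}(S)$; for such a subset $C$, $(C,\underline{I}^{o}(S))$ denotes the algebra with universe $C$ and these operations. An $F$-convex subset of $F^n$ is thus a nonempty subset of $F^n$ closed under all operations $\underline p$, $p\in F$, $0<p<1$. A geometric convex subset of $F^n$ is a nonempty set of the form $D\cap F^n$, where $D$ is a convex subset (in the usual sense) of $\mathbb R^n$. Automorphisms of the affine $F$-space $F^n$ are the maps $x\mapsto Ax+b$ with $A$ an invertible $n\times n$ matrix over $F$ and $b\in F^n$ (and similarly with $\mathbb R$ in place of $F$). The affine $F$-dimension of $X\subseteq F^n$ is the dimension of the affine $F$-subspace spanned by $X$. A set $X\subseteq F^n$ is bounded if the set of Euclidean distances between its points is a bounded subset of $\mathbb R$. *)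

theory Defs
  imports "HOL-Analysis.Analysis"
begin

text \<open>Subrings (with 1) and subfields of the reals, as subsets of the type of reals.
  Note \<^term>\<open>inverse 0 = (0::real)\<close>, so closure under inverses needs no side condition.\<close>

definition real_subring :: "real set \<Rightarrow> bool" where
  "real_subring S \<longleftrightarrow> 0 \<in> S \<and> 1 \<in> S \<and>
     (\<forall>x\<in>S. \<forall>y\<in>S. x + y \<in> S \<and> x * y \<in> S) \<and> (\<forall>x\<in>S. - x \<in> S)"

definition real_subfield :: "real set \<Rightarrow> bool" where
  "real_subfield F \<longleftrightarrow> real_subring F \<and> (\<forall>x\<in>F. inverse x \<in> F)"

text \<open>The set $F^n$ inside $\mathbf{R}^n$.\<close>

definition coord_space :: "real set \<Rightarrow> (real ^ 'n) set" where
  "coord_space F = {x. \<forall>i. x $ i \<in> F}"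

definition open_unit :: "real set \<Rightarrow> real set" where
  "open_unit S = {p \<in> S. 0 < p \<and> p < 1}"

definition bary_op :: "real \<Rightarrow> real ^ 'n \<Rightarrow> real ^ 'n \<Rightarrow> real ^ 'n" where
  "bary_op p x y = (1 - p) *\<^sub>R x + p *\<^sub>R y"

definition convex_over :: "real set \<Rightarrow> (real ^ 'n) set \<Rightarrow> bool" where
  "convex_over S C \<longleftrightarrow>
     C \<noteq> {} \<and> (\<forall>p \<in> open_unit S. \<forall>x\<in>C. \<forall>y\<in>C. bary_op p x y \<in> C)"

text \<open>Isomorphism of the algebras with universes \<open>C\<close>, \<open>C'\<close> and one binary operation
  \<^term>\<open>bary_op p\<close> for each \<open>p \<in> open_unit T\<close>.\<close>

definition barycentric_isomorphic :: "real set \<Rightarrow> (real ^ 'n) set \<Rightarrow> (real ^ 'n) set \<Rightarrow> bool" where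
  "barycentric_isomorphic T C C' \<longleftrightarrow>
     (\<exists>\<phi>. bij_betw \<phi> C C' \<and>
       (\<forall>p \<in> open_unit T. \<forall>x\<in>C. \<forall>y\<in>C. \<phi> (bary_op p x y) = bary_op p (\<phi> x) (\<phi> y)))"

definition matrix_over :: "real set \<Rightarrow> real ^ 'n ^ 'n \<Rightarrow> bool" where
  "matrix_over F A \<longleftrightarrow> (\<forall>i j. A $ i $ j \<in> F)"

text \<open>Automorphisms of the affine space $F^n$. Only the values of \<open>\<psi>\<close> on
  \<^term>\<open>coord_space F\<close> matter, and the inverse matrix is required to have entries in \<open>F\<close>.
  The real affine space is the case \<open>F = UNIV\<close>.\<close>

definition affine_automorphism :: "real set \<Rightarrow> (real ^ 'n \<Rightarrow> real ^ 'n) \<Rightarrow> bool" where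
  "affine_automorphism F \<psi> \<longleftrightarrow>
     (\<exists>A b. matrix_over F A \<and>
        (\<exists>A'. matrix_over F A' \<and> A ** A' = mat 1 \<and> A' ** A = mat 1) \<and>
        b \<in> coord_space F \<and>
        (\<forall>x \<in> coord_space F. \<psi> x = A *v x + b))"

text \<open>Linear and affine algebra with scalars restricted to \<open>F\<close>. The library versions take
  their scalars from a whole type; the definitions below are those of \<^const>\<open>subspace\<close>,
  \<^const>\<open>span\<close>, \<^const>\<open>dependent\<close>, \<^const>\<open>dim\<close> and \<^const>\<open>affine\<close>
  with scalars in \<open>F\<close>.\<close>

definition subspace_over :: "real set \<Rightarrow> (real ^ 'n) set \<Rightarrow> bool" where
  "subspace_over F V \<longleftrightarrow>
     0 \<in> V \<and> (\<forall>x\<in>V. \<forall>y\<in>V. x + y \<in> V) \<and> (\<forall>c\<in>F. \<forall>x\<in>V. c *\<^sub>R x \<in> V)"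

definition span_over :: "real set \<Rightarrow> (real ^ 'n) set \<Rightarrow> (real ^ 'n) set" where
  "span_over F B = subspace_over F hull B"

definition dependent_over :: "real set \<Rightarrow> (real ^ 'n) set \<Rightarrow> bool" where
  "dependent_over F B \<longleftrightarrow>
     (\<exists>S u. finite S \<and> S \<subseteq> B \<and> u ` S \<subseteq> F \<and>
        (\<Sum>v\<in>S. u v *\<^sub>R v) = 0 \<and> (\<exists>v\<in>S. u v \<noteq> 0))"

definition dim_over :: "real set \<Rightarrow> (real ^ 'n) set \<Rightarrow> nat" where
  "dim_over F V = card (SOME B. \<not> dependent_over F B \<and> span_over F B = span_over F V)"

definition affine_over :: "real set \<Rightarrow> (real ^ 'n) set \<Rightarrow> bool" where
  "affine_over F A \<longleftrightarrow>
     (\<forall>x\<in>A. \<forall>y\<in>A. \<forall>u\<in>F. \<forall>v\<in>F. u + v = 1 \<longrightarrow> u *\<^sub>R x + v *\<^sub>R y \<in> A)"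

text \<open>Dimension of the affine \<open>F\<close>-subspace spanned by \<open>X\<close>, that is, the \<open>F\<close>-dimension of
  its direction space; meant for nonempty \<open>X \<subseteq> coord_space F\<close>.\<close>

definition aff_dim_over :: "real set \<Rightarrow> (real ^ 'n) set \<Rightarrow> nat" where
  "aff_dim_over F X =
     dim_over F {x - y | x y. x \<in> affine_over F hull X \<and> y \<in> affine_over F hull X}"

end

theory Submission
  imports Defs
begin

text \<open>The three conditions are linked through a fourth one, isomorphism of \<open>C\<close> and \<open>C'\<close> as
  \<open>F\<close>-barycentric algebras. An automorphism of \<open>F^n\<close> extends to one of the real space by the same
  formula, and a real automorphism that carries \<open>C\<close> onto \<open>C'\<close> preserves all weighted means, so it
  is in particular an \<open>F\<close>- and a \<open>T\<close>-isomorphism. Two steps have content.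

  Rigidity (\<open>barycentric_isomorphic_rigid\<close>): a \<open>T\<close>-isomorphism is an \<open>F\<close>-isomorphism. Bezout's
  identity puts some \<open>1/m\<close> with \<open>m \<ge> 2\<close> into \<open>T\<close>. On a segment of \<open>C\<close>, parametrized by
  \<open>F \<inter> [0,1]\<close>, the deviation \<open>g\<close> of the map from the affine map with the same end values vanishes at both
  ends and respects means with weight \<open>1/m\<close>; this already makes \<open>g\<close> additive. Hence \<open>g\<close> vanishes at all
  rational parameters. For \<open>F = \<rat>\<close> nothing is left. Otherwise Cauchy's argument for bounded additive
  functions applies when \<open>C'\<close> is bounded; when \<open>C\<close> is bounded it applies to the inverse map, and
  the inverse of an \<open>F\<close>-isomorphism is again one.

  Linearization (\<open>barycentric_isomorphic_imp_automorphism\<close>): an \<open>F\<close>-isomorphism is the restriction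
  of an automorphism of \<open>F^n\<close>. After translation it fixes \<open>0\<close>, and then it respects all
  \<open>F\<close>-linear combinations that stay in \<open>C\<close>, since the terms of negative sign can be moved to
  the other side and everything scaled down into \<open>C\<close>. By the same property of the inverse, a maximal
  linearly independent subset of \<open>C\<close> is sent to a linearly independent set. Both sets extend to
  bases of \<open>F^n\<close>, and matching these bases gives the automorphism.

  Linear algebra over \<open>F\<close> is done inside real linear algebra: by Cramer's rule
  (\<open>representation_in_subfield\<close>), the real coordinates of a vector of \<open>F^n\<close> with respect to a real
  basis consisting of vectors of \<open>F^n\<close> lie in \<open>F\<close>.\<close>

section \<open>Subfields of the reals\<close>

lemma Rats_subset_subfield: "real_subfield F \<Longrightarrow> \<rat> \<subseteq> F"
proof -
  assume F: "real_subfield F"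
  have nat: "real n \<in> F" for n :: nat
    using F by (induction n) (auto simp: real_subfield_def real_subring_def)
  have int: "real_of_int i \<in> F" for i
    using F nat by (cases i rule: int_cases2) (auto simp: real_subfield_def real_subring_def)
  have "real_of_int a / real_of_int b \<in> F" for a b
    using F int unfolding real_subfield_def real_subring_def divide_inverse by blast
  then show ?thesis
    by (auto elim!: Rats_cases')
qed

lemma subfield_closed:
  assumes "real_subfield F"
  shows "0 \<in> F" "1 \<in> F"
    and "x \<in> F \<Longrightarrow> y \<in> F \<Longrightarrow> x + y \<in> F"
    and "x \<in> F \<Longrightarrow> y \<in> F \<Longrightarrow> x * y \<in> F"
    and "x \<in> F \<Longrightarrow> - x \<in> F"
    and "x \<in> F \<Longrightarrow> y \<in> F \<Longrightarrow> x - y \<in> F"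
    and "x \<in> F \<Longrightarrow> y \<in> F \<Longrightarrow> x / y \<in> F"
    and "x \<in> F \<Longrightarrow> \<bar>x\<bar> \<in> F"
    and "of_nat n \<in> F" "of_int i \<in> F"
proof -
  have add: "x + y \<in> F" and mult: "x * y \<in> F" if "x \<in> F" "y \<in> F" for x y
    using assms that by (auto simp: real_subfield_def real_subring_def)
  have neg: "- x \<in> F" and inv: "inverse x \<in> F" if "x \<in> F" for x
    using assms that by (auto simp: real_subfield_def real_subring_def)
  show "0 \<in> F" "1 \<in> F" using assms by (auto simp: real_subfield_def real_subring_def)
  show "x \<in> F \<Longrightarrow> y \<in> F \<Longrightarrow> x + y \<in> F" "x \<in> F \<Longrightarrow> y \<in> F \<Longrightarrow> x * y \<in> F"
    "x \<in> F \<Longrightarrow> - x \<in> F" "x \<in> F \<Longrightarrow> \<bar>x\<bar> \<in> F"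
    using add mult neg by (auto simp: abs_if)
  show "x \<in> F \<Longrightarrow> y \<in> F \<Longrightarrow> x - y \<in> F" using add[of x "- y"] neg by simp
  show "x \<in> F \<Longrightarrow> y \<in> F \<Longrightarrow> x / y \<in> F" using mult inv by (simp add: divide_inverse)
  show "of_nat n \<in> F" "of_int i \<in> F" using Rats_subset_subfield[OF assms] by auto
qed

lemma subfield_sum:
  assumes "real_subfield F" "\<And>i. i \<in> A \<Longrightarrow> f i \<in> F"
  shows "sum f A \<in> F"
  using assms(2) by (induction A rule: infinite_finite_induct) (auto simp: subfield_closed[OF assms(1)])

lemma subfield_prod:
  assumes "real_subfield F" "\<And>i. i \<in> A \<Longrightarrow> f i \<in> F"
  shows "prod f A \<in> F"
  using assms(2) by (induction A rule: infinite_finite_induct) (auto simp: subfield_closed[OF assms(1)])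

lemma subfield_det:
  assumes "real_subfield F" "matrix_over F A"
  shows "det A \<in> F"
  using assms(2) unfolding det_def matrix_over_def
  by (intro subfield_sum[OF assms(1)] subfield_closed[OF assms(1)] subfield_prod[OF assms(1)]) auto

lemma coord_space_sum_scaleR:
  assumes "real_subfield F" "\<And>i. i \<in> A \<Longrightarrow> c i \<in> F" "\<And>i. i \<in> A \<Longrightarrow> v i \<in> coord_space F"
  shows "(\<Sum>i\<in>A. c i *\<^sub>R v i) \<in> coord_space F"
  using assms(2,3) unfolding coord_space_def
  by (auto intro!: subfield_sum[OF assms(1)] subfield_closed[OF assms(1)])

lemma coord_space_diff:
  "real_subfield F \<Longrightarrow> x \<in> coord_space F \<Longrightarrow> y \<in> coord_space F \<Longrightarrow> x - y \<in> coord_space F"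
  by (auto simp: coord_space_def subfield_closed)

lemma coord_space_matrix_vector:
  assumes "real_subfield F" "matrix_over F A" "x \<in> coord_space F"
  shows "A *v x \<in> coord_space F"
  using assms(2,3) unfolding coord_space_def matrix_over_def matrix_vector_mult_def
  by (auto intro!: subfield_sum[OF assms(1)] subfield_closed[OF assms(1)])

section \<open>Linear algebra over a subfield inside real linear algebra\<close>

lemma axis_in_coord_space: "real_subfield F \<Longrightarrow> axis i 1 \<in> coord_space F"
  by (auto simp: coord_space_def axis_def subfield_closed)

lemma span_coord_space:
  assumes "real_subfield F"
  shows "span (coord_space F :: (real^'n) set) = UNIV"
proof -
  have "(Basis :: (real^'n) set) \<subseteq> coord_space F"
    using axis_in_coord_space[OF assms] by (auto simp: Basis_vec_def)
  then show ?thesis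
    using span_mono span_Basis by blast
qed

lemma extend_to_basis_in_coord_space:
  assumes "real_subfield F" "independent B" "B \<subseteq> coord_space F"
  obtains D where "B \<subseteq> D" "D \<subseteq> coord_space F" "independent D" "span D = (UNIV :: (real^'n) set)"
proof -
  obtain D where D: "B \<subseteq> D" "D \<subseteq> coord_space F" "independent D" "coord_space F \<subseteq> span D"
    using maximal_independent_subset_extend[OF assms(3,2)] by metis
  have "span D = UNIV"
    using span_coord_space[OF assms(1)] span_minimal[OF D(4) subspace_span] by auto
  with D that show thesis by blast
qed

lemma card_basis:
  assumes "independent D" "span D = (UNIV :: (real^'n) set)"
  shows "finite D" "card D = CARD('n)"
proof -
  show "finite D" using assms(1) independent_imp_finite by blast
  have "card D = dim (span D)" using assms(1) dim_span_eq_card_independent by metis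
  then show "card D = CARD('n)" using assms(2) by simp
qed

text \<open>The coordinates solve a linear system whose matrix, with the basis vectors as columns, and whose
  right-hand side have entries in \<open>F\<close>; Cramer's rule expresses the solution as quotients of
  determinants over \<open>F\<close>.\<close>

lemma representation_in_subfield:
  fixes D :: "(real^'n) set"
  assumes F: "real_subfield F" and D: "independent D" "span D = UNIV" "D \<subseteq> coord_space F"
    and v: "v \<in> coord_space F"
  shows "representation D v x \<in> F"
proof (cases "x \<in> D")
  case False
  then have "representation D v x = 0" using representation_ne_zero by blast
  then show ?thesis using subfield_closed(1)[OF F] by simp
next
  case True
  have "finite D" "card D = card (UNIV :: 'n set)" using card_basis[OF D(1,2)] by auto
  then obtain e :: "'n \<Rightarrow> real^'n" where e: "bij_betw e UNIV D"
    using finite_same_card_bij[of "UNIV :: 'n set" D] by auto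
  define P :: "real^'n^'n" where "P = (\<chi> i j. e j $ i)"
  define c where "c = (\<chi> j. representation D v (e j))"
  have "columns P = D"
    using e by (auto simp: columns_def column_def P_def bij_betw_def vec_nth_inverse)
  then have "invertible P"
    using D(2) matrix_right_invertible_span_columns[of P] invertible_right_inverse[of P]
    by (simp add: span_vec_eq)
  then have det: "det P \<noteq> 0" by (simp add: invertible_det_nz)
  have "(\<Sum>j\<in>UNIV. representation D v (e j) *\<^sub>R e j) = (\<Sum>b\<in>D. representation D v b *\<^sub>R b)"
    by (rule sum.reindex_bij_betw[OF e])
  also have "\<dots> = v"
    using sum_representation_eq[OF D(1) _ \<open>finite D\<close>, of v] D(2) by simp
  finally have "P *v c = v"
    by (auto simp: vec_eq_iff matrix_vector_mult_def P_def c_def mult.commute)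
  then have "c = (\<chi> k. det (\<chi> i j. if j = k then v $ i else P $ i $ j) / det P)"
    using cramer[OF det] by blast
  then have ceq: "c $ k = det (\<chi> i j. if j = k then v $ i else P $ i $ j) / det P" for k
    by simp
  have P: "matrix_over F P"
    using e D(3) by (auto simp: matrix_over_def P_def coord_space_def bij_betw_def)
  moreover have "matrix_over F (\<chi> i j. if j = k then v $ i else P $ i $ j)" for k
    using P v by (simp add: matrix_over_def coord_space_def)
  ultimately have "c $ k \<in> F" for k
    unfolding ceq by (intro subfield_closed(7)[OF F] subfield_det[OF F])
  moreover obtain k where "x = e k" using True e by (auto simp: bij_betw_def)
  ultimately show ?thesis by (simp add: c_def)
qed

text \<open>This lets real spans stand for spans over \<open>F\<close>: completing an independent subset of \<open>B\<close> to a basis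
  of vectors in \<open>F^n\<close> does not change the coordinates of a vector in its span.\<close>

lemma span_combination_over_subfield:
  fixes B :: "(real^'n) set"
  assumes F: "real_subfield F" and B: "B \<subseteq> coord_space F"
    and v: "v \<in> coord_space F" "v \<in> span B"
  obtains S c where "finite S" "S \<subseteq> B" "\<And>x. c x \<in> F" "v = (\<Sum>x\<in>S. c x *\<^sub>R x)"
proof -
  obtain S where S: "S \<subseteq> B" "independent S" "B \<subseteq> span S"
    using maximal_independent_subset[of B] by metis
  have vS: "v \<in> span S" using v(2) S(3) span_mono span_span by blast
  obtain D where D: "S \<subseteq> D" "D \<subseteq> coord_space F" "independent D" "span D = (UNIV :: (real^'n) set)"
    using extend_to_basis_in_coord_space[OF F S(2)] S(1) B by blast
  have "representation S v x \<in> F" for x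
    using representation_in_subfield[OF F D(3,4,2) v(1)] representation_extend[OF D(3) vS D(1)]
    by simp
  moreover have "finite S" using S(2) independent_imp_finite by blast
  moreover have "v = (\<Sum>x\<in>S. representation S v x *\<^sub>R x)"
    using sum_representation_eq[OF S(2) vS \<open>finite S\<close> order_refl] by simp
  ultimately show thesis using that S(1) by blast
qed

text \<open>The standard basis vectors are \<open>F\<close>-combinations of \<open>B\<close>, so their images, the columns of the
  matrix, are \<open>F\<close>-combinations of vectors in \<open>F^n\<close>.\<close>

lemma linear_extension_in_coord_space:
  fixes B :: "(real^'n) set"
  assumes F: "real_subfield F" and B: "B \<subseteq> coord_space F" "span B = UNIV"
    and g: "linear g" "g ` B \<subseteq> coord_space F"
  shows "matrix_over F (matrix g)"
proof -
  have "g (axis i 1) \<in> coord_space F" for i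
  proof -
    have "axis i 1 \<in> span B" using B(2) by simp
    then obtain S c where S: "finite S" "S \<subseteq> B" "\<And>x. c x \<in> F" "axis i 1 = (\<Sum>x\<in>S. c x *\<^sub>R x)"
      using span_combination_over_subfield[OF F B(1) axis_in_coord_space[OF F]] by blast
    have "g (axis i 1) = (\<Sum>x\<in>S. c x *\<^sub>R g x)"
      unfolding S(4) by (simp add: linear_sum[OF g(1)] linear_cmul[OF g(1)])
    also have "\<dots> \<in> coord_space F"
      using S g(2) by (intro coord_space_sum_scaleR[OF F]) auto
    finally show ?thesis .
  qed
  then show ?thesis by (auto simp: matrix_over_def matrix_def coord_space_def)
qed

text \<open>Completing \<open>B\<close> and \<open>D\<close> to bases adds equally many vectors to both, so \<open>j\<close> extends to a bijection
  of bases; this bijection and its inverse have linear extensions that are inverse to each other.\<close>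

lemma independent_bij_extends_to_invertible_matrix:
  fixes B D :: "(real^'n) set"
  assumes F: "real_subfield F"
    and B: "independent B" "B \<subseteq> coord_space F" and D: "independent D" "D \<subseteq> coord_space F"
    and j: "bij_betw j B D"
  obtains A A' where "matrix_over F A" "matrix_over F A'" "A ** A' = mat 1" "A' ** A = mat 1"
    "\<And>x. x \<in> B \<Longrightarrow> A *v x = j x"
proof -
  obtain B1 where B1: "B \<subseteq> B1" "B1 \<subseteq> coord_space F" "independent B1" "span B1 = (UNIV :: (real^'n) set)"
    using extend_to_basis_in_coord_space[OF F B] by blast
  obtain D1 where D1: "D \<subseteq> D1" "D1 \<subseteq> coord_space F" "independent D1" "span D1 = (UNIV :: (real^'n) set)"
    using extend_to_basis_in_coord_space[OF F D] by blast
  note fB = card_basis[OF B1(3,4)] and fD = card_basis[OF D1(3,4)]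
  have "card (B1 - B) = card (D1 - D)"
    using fB fD B1(1) D1(1) bij_betw_same_card[OF j]
    by (simp add: card_Diff_subset finite_subset[OF B1(1) fB(1)] finite_subset[OF D1(1) fD(1)])
  then obtain k where k: "bij_betw k (B1 - B) (D1 - D)"
    using finite_same_card_bij[OF finite_Diff[OF fB(1)] finite_Diff[OF fD(1)]] by blast
  define l where "l x = (if x \<in> B then j x else k x)" for x
  have "bij_betw l B D" "bij_betw l (B1 - B) (D1 - D)"
    using j k bij_betw_cong[of B l j D] bij_betw_cong[of "B1 - B" l k "D1 - D"]
    by (simp_all add: l_def)
  from bij_betw_combine[OF this] have l: "bij_betw l B1 D1"
    using B1(1) D1(1) by (simp add: Un_absorb1)
  obtain g where g: "linear g" "\<And>x. x \<in> B1 \<Longrightarrow> g x = l x"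
    using linear_independent_extend[OF B1(3), of l] by auto
  obtain g' where g': "linear g'" "\<And>x. x \<in> D1 \<Longrightarrow> g' x = inv_into B1 l x"
    using linear_independent_extend[OF D1(3), of "inv_into B1 l"] by auto
  have "g' (g x) = x" if "x \<in> B1" for x
    using that g(2) g'(2) l by (metis bij_betw_inv_into_left bij_betwE)
  then have 1: "g' \<circ> g = id"
    using linear_eq_on_span[of "g' \<circ> g" id B1] linear_compose[OF g(1) g'(1)] linear_id B1(4)
    by (auto simp: fun_eq_iff)
  have "g (g' x) = x" if "x \<in> D1" for x
    using that g(2) g'(2) l by (metis bij_betw_inv_into_right bij_betw_inv_into bij_betwE)
  then have 2: "g \<circ> g' = id"
    using linear_eq_on_span[of "g \<circ> g'" id D1] linear_compose[OF g'(1) g(1)] linear_id D1(4)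
    by (auto simp: fun_eq_iff)
  have "matrix_over F (matrix g)"
    using l g(2) D1(2) by (intro linear_extension_in_coord_space[OF F B1(2,4) g(1)]) (auto simp: bij_betw_def)
  moreover have "matrix_over F (matrix g')"
    using bij_betw_inv_into[OF l] g'(2) B1(2)
    by (intro linear_extension_in_coord_space[OF F D1(2,4) g'(1)]) (auto simp: bij_betw_def)
  moreover have "matrix g ** matrix g' = mat 1" "matrix g' ** matrix g = mat 1"
    using matrix_compose[OF g'(1) g(1)] matrix_compose[OF g(1) g'(1)] 1 2
    by (simp_all add: matrix_id_mat_1)
  moreover have "matrix g *v x = j x" if "x \<in> B" for x
    using that B1(1) g(2) fun_cong[OF matrix_vector_mul(2)[OF g(1)], of x] by (auto simp: l_def)
  ultimately show thesis using that by blast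
qed

section \<open>Barycentric maps over a subfield are affine\<close>

definition barycentric_map :: "real set \<Rightarrow> (real^'n) set \<Rightarrow> (real^'n \<Rightarrow> real^'n) \<Rightarrow> bool" where
  "barycentric_map S C f \<longleftrightarrow>
     (\<forall>p\<in>open_unit S. \<forall>x\<in>C. \<forall>y\<in>C. f (bary_op p x y) = bary_op p (f x) (f y))"

lemma barycentric_map_inverse:
  assumes "convex_over S C" "bij_betw f C C'" "barycentric_map S C f"
  shows "barycentric_map S C' (inv_into C f)"
  unfolding barycentric_map_def
proof (intro ballI)
  fix p x y assume p: "p \<in> open_unit S" and "x \<in> C'" "y \<in> C'"
  then obtain u v where uv: "u \<in> C" "v \<in> C" "x = f u" "y = f v"
    using assms(2) by (auto simp: bij_betw_def)
  have "bary_op p u v \<in> C" using assms(1) p uv by (auto simp: convex_over_def)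
  moreover have "bary_op p x y = f (bary_op p u v)"
    using assms(3) p uv by (simp add: barycentric_map_def)
  ultimately show "inv_into C f (bary_op p x y) = bary_op p (inv_into C f x) (inv_into C f y)"
    using uv assms(2) by (simp add: bij_betw_inv_into_left)
qed

text \<open>Since \<open>0\<close> lies in \<open>C\<close> and is fixed, weights of total at most one are admissible: the missing
  weight goes to \<open>0\<close>. This freedom lets combinations be scaled down below.\<close>

lemma barycentric_map_subconvex_combination:
  assumes F: "real_subfield F" and C: "convex_over F C" "0 \<in> C"
    and f: "barycentric_map F C f" "f 0 = 0"
    and S: "finite S" "S \<subseteq> C"
  shows "(\<And>x. w x \<in> F) \<Longrightarrow> (\<And>x. 0 \<le> w x) \<Longrightarrow> sum w S \<le> 1 \<Longrightarrow>
    (\<Sum>x\<in>S. w x *\<^sub>R x) \<in> C \<and> f (\<Sum>x\<in>S. w x *\<^sub>R x) = (\<Sum>x\<in>S. w x *\<^sub>R f x)"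
  using S
proof (induction S arbitrary: w rule: finite_induct)
  case empty
  then show ?case using C f by simp
next
  case (insert a S)
  let ?y = "\<Sum>x\<in>S. (w x / (1 - w a)) *\<^sub>R x"
  have sum: "w a + sum w S \<le> 1" using insert by simp
  have nonneg: "0 \<le> sum w S" "0 \<le> w a" using insert by (auto intro: sum_nonneg)
  consider "w a = 0" | "w a = 1" | "0 < w a" "w a < 1" using sum nonneg by linarith
  then show ?case
  proof cases
    case 1
    then show ?thesis using insert by auto
  next
    case 2
    then have "sum w S = 0" using sum nonneg by linarith
    then have "\<forall>x\<in>S. w x = 0" using insert by (simp add: sum_nonneg_eq_0_iff)
    then show ?thesis using 2 insert by simp
  next
    case 3
    have "w x / (1 - w a) \<in> F" for x
      by (intro subfield_closed[OF F] insert.prems)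
    moreover have "0 \<le> w x / (1 - w a)" for x
      using insert.prems(2)[of x] 3 by simp
    moreover have "(\<Sum>x\<in>S. w x / (1 - w a)) \<le> 1"
      using sum 3 by (simp add: sum_divide_distrib[symmetric])
    ultimately have IH: "?y \<in> C" "f ?y = (\<Sum>x\<in>S. (w x / (1 - w a)) *\<^sub>R f x)"
      using insert.IH[of "\<lambda>x. w x / (1 - w a)"] insert.prems(4) by blast+
    have p: "w a \<in> open_unit F" using 3 insert by (simp add: open_unit_def)
    have eq: "bary_op (w a) (\<Sum>x\<in>S. (w x / (1 - w a)) *\<^sub>R h x) z = w a *\<^sub>R z + (\<Sum>x\<in>S. w x *\<^sub>R h x)"
      for h and z :: "real^'a"
      using 3 by (simp add: bary_op_def scaleR_sum_right)
    have "bary_op (w a) ?y a \<in> C" "f (bary_op (w a) ?y a) = bary_op (w a) (f ?y) (f a)"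
      using C f p IH(1) insert.prems by (auto simp: convex_over_def barycentric_map_def)
    then show ?thesis using IH(2) insert.hyps by (simp add: eq)
  qed
qed

text \<open>Split the coefficients into positive and negative parts. The identity
  \<open>z + (\<Sum>x. neg x * x) = (\<Sum>x. pos x * x)\<close>, divided by \<open>2 * N\<close>, becomes
  an identity between subconvex combinations in \<open>C\<close>, which \<open>f\<close> respects.\<close>

lemma barycentric_map_linear_combination:
  assumes F: "real_subfield F" and C: "convex_over F C" "0 \<in> C"
    and f: "barycentric_map F C f" "f 0 = 0"
    and S: "finite S" "S \<subseteq> C" and c: "\<And>x. c x \<in> F"
    and inC: "(\<Sum>x\<in>S. c x *\<^sub>R x) \<in> C"
  shows "f (\<Sum>x\<in>S. c x *\<^sub>R x) = (\<Sum>x\<in>S. c x *\<^sub>R f x)"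
proof -
  define z where "z = (\<Sum>x\<in>S. c x *\<^sub>R x)"
  define N where "N = 1 + (\<Sum>x\<in>S. \<bar>c x\<bar>)"
  define pos where "pos x = max (c x) 0" for x
  define neg where "neg x = max (- c x) 0" for x
  have N: "1 \<le> N" "N \<in> F"
    unfolding N_def by (auto intro!: sum_nonneg subfield_closed[OF F] subfield_sum[OF F] c)
  have inF: "pos x \<in> F" "neg x \<in> F" for x
    using c[of x] by (auto simp: pos_def neg_def max_def subfield_closed[OF F])
  have "sum pos S \<le> (\<Sum>x\<in>S. \<bar>c x\<bar>)" "sum neg S \<le> (\<Sum>x\<in>S. \<bar>c x\<bar>)"
    by (auto intro!: sum_mono simp: pos_def neg_def)
  then have le: "sum pos S \<le> N" "sum neg S \<le> N" by (auto simp: N_def)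
  have half: "1/2 \<in> open_unit F"
    using Rats_subset_subfield[OF F] by (auto simp: open_unit_def)
  have comb: "(\<Sum>x\<in>S. (w x / k) *\<^sub>R x) \<in> C \<and>
      f (\<Sum>x\<in>S. (w x / k) *\<^sub>R x) = (\<Sum>x\<in>S. (w x / k) *\<^sub>R f x)"
    if "\<And>x. w x \<in> F" "\<And>x. 0 \<le> w x" "sum w S \<le> N" "k = N \<or> k = 2 * N" for w k
  proof (rule barycentric_map_subconvex_combination[OF F C f S])
    have k: "N \<le> k" "k \<in> F" "0 < k" using that(4) N subfield_closed(3)[OF F N(2) N(2)] by auto
    show "w x / k \<in> F" "0 \<le> w x / k" for x
      using that k by (auto simp: subfield_closed[OF F])
    show "(\<Sum>x\<in>S. w x / k) \<le> 1"
      using that k by (simp add: sum_divide_distrib[symmetric])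
  qed
  note posc = comb[of pos "2 * N", OF inF(1) _ le(1)] and negc = comb[of neg N, OF inF(2) _ le(2)]
  have zN: "(1 / N) *\<^sub>R z \<in> C \<and> f ((1 / N) *\<^sub>R z) = (1 / N) *\<^sub>R f z"
  proof -
    have "1 / N \<in> F" "0 \<le> 1 / N" "1 / N \<le> 1" using N by (auto intro: subfield_closed[OF F])
    moreover have "{z} \<subseteq> C" using inC by (simp add: z_def)
    ultimately show ?thesis
      using barycentric_map_subconvex_combination[OF F C f _ \<open>{z} \<subseteq> C\<close>, of "\<lambda>_. 1 / N"] by simp
  qed
  \<comment> \<open>The scaled identity, for an arbitrary family \<open>h\<close> of vectors in place of the points \<open>x\<close>: it is used
    from right to left for the points and from left to right for their images.\<close>
  have split: "bary_op (1/2) ((1 / N) *\<^sub>R u) (\<Sum>x\<in>S. (neg x / N) *\<^sub>R h x) =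
      (\<Sum>x\<in>S. (pos x / (2 * N)) *\<^sub>R h x) \<longleftrightarrow> u = (\<Sum>x\<in>S. c x *\<^sub>R h x)" for u and h :: "_ \<Rightarrow> real^'a"
  proof -
    have "(pos x / (2 * N)) *\<^sub>R h x = (1 / (2 * N)) *\<^sub>R (c x *\<^sub>R h x) + (neg x / (2 * N)) *\<^sub>R h x" for x
    proof -
      have "pos x = c x + neg x" by (simp add: pos_def neg_def max_def)
      then show ?thesis by (simp add: add_divide_distrib scaleR_left_distrib)
    qed
    then have "(\<Sum>x\<in>S. (pos x / (2 * N)) *\<^sub>R h x) =
        (1 / (2 * N)) *\<^sub>R (\<Sum>x\<in>S. c x *\<^sub>R h x) + (\<Sum>x\<in>S. (neg x / (2 * N)) *\<^sub>R h x)"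
      by (simp only: sum.distrib scaleR_sum_right)
    moreover have "bary_op (1/2) ((1 / N) *\<^sub>R u) (\<Sum>x\<in>S. (neg x / N) *\<^sub>R h x) =
        (1 / (2 * N)) *\<^sub>R u + (\<Sum>x\<in>S. (neg x / (2 * N)) *\<^sub>R h x)"
      by (simp add: bary_op_def scaleR_sum_right)
    ultimately show ?thesis using N by simp
  qed
  have "f (bary_op (1/2) ((1 / N) *\<^sub>R z) (\<Sum>x\<in>S. (neg x / N) *\<^sub>R x)) =
      bary_op (1/2) ((1 / N) *\<^sub>R f z) (\<Sum>x\<in>S. (neg x / N) *\<^sub>R f x)"
    using f(1) half zN negc by (auto simp: barycentric_map_def neg_def)
  moreover have "bary_op (1/2) ((1 / N) *\<^sub>R z) (\<Sum>x\<in>S. (neg x / N) *\<^sub>R x) = (\<Sum>x\<in>S. (pos x / (2 * N)) *\<^sub>R x)"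
    using split[of z "\<lambda>x. x"] by (simp add: z_def)
  moreover have "f (\<Sum>x\<in>S. (pos x / (2 * N)) *\<^sub>R x) = (\<Sum>x\<in>S. (pos x / (2 * N)) *\<^sub>R f x)"
    using posc by (simp add: pos_def)
  ultimately show ?thesis
    using split[of "f z" f] by (simp add: z_def)
qed

lemma barycentric_map_span:
  assumes F: "real_subfield F" and C: "C \<subseteq> coord_space F" "convex_over F C" "0 \<in> C"
    and f: "barycentric_map F C f" "f 0 = 0"
    and B: "B \<subseteq> C" and v: "v \<in> C" "v \<in> span B"
  obtains S c where "finite S" "S \<subseteq> B" "v = (\<Sum>x\<in>S. c x *\<^sub>R x)" "f v = (\<Sum>x\<in>S. c x *\<^sub>R f x)"
proof -
  obtain S c where S: "finite S" "S \<subseteq> B" "\<And>x. c x \<in> F" "v = (\<Sum>x\<in>S. c x *\<^sub>R x)"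
    using span_combination_over_subfield[OF F, of B v] B C(1) v by blast
  have "f v = (\<Sum>x\<in>S. c x *\<^sub>R f x)"
    using barycentric_map_linear_combination[OF F C(2,3) f S(1) _ S(3)] S B v(1) by simp
  with S that show thesis by blast
qed

text \<open>A maximal independent \<open>B \<subseteq> C\<close> determines \<open>f\<close> on all of \<open>C\<close>. Its image is independent because
  the inverse of \<open>f\<close> carries a linear dependence in \<open>f ` B\<close> back to one in \<open>B\<close>.\<close>

lemma barycentric_bijection_linear:
  fixes C C' :: "(real^'n) set"
  assumes F: "real_subfield F"
    and C: "C \<subseteq> coord_space F" "convex_over F C" "0 \<in> C"
    and C': "C' \<subseteq> coord_space F" "convex_over F C'"
    and f: "bij_betw f C C'" "barycentric_map F C f" "f 0 = 0"
  obtains A A' where "matrix_over F A" "matrix_over F A'" "A ** A' = mat 1" "A' ** A = mat 1"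
    "\<And>x. x \<in> C \<Longrightarrow> A *v x = f x"
proof -
  obtain B where B: "B \<subseteq> C" "independent B" "C \<subseteq> span B"
    using maximal_independent_subset[of C] by metis
  let ?g = "inv_into C f"
  have gf: "?g (f x) = x" if "x \<in> C" for x
    using that f(1) by (simp add: bij_betw_inv_into_left)
  have fC: "f x \<in> C'" if "x \<in> C" for x using that f(1) by (auto simp: bij_betw_def)
  have g: "barycentric_map F C' ?g" "?g 0 = 0" "0 \<in> C'"
    using barycentric_map_inverse[OF C(2) f(1,2)] gf[OF C(3)] fC[OF C(3)] f(3) by auto
  have inj: "inj_on f B" using f(1) B(1) by (auto simp: bij_betw_def intro: inj_on_subset)
  have "independent (f ` B)"
  proof
    assume "dependent (f ` B)"
    then obtain b where b: "b \<in> B" "f b \<in> span (f ` B - {f b})" by (auto simp: dependent_def)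
    have "f ` B - {f b} = f ` (B - {b})" using inj b(1) by (auto simp: inj_on_def)
    then have span: "f b \<in> span (f ` (B - {b}))" using b(2) by simp
    have sub: "f ` (B - {b}) \<subseteq> C'" "f b \<in> C'" using fC B(1) b(1) by auto
    obtain S c where S: "S \<subseteq> f ` (B - {b})" "?g (f b) = (\<Sum>x\<in>S. c x *\<^sub>R ?g x)"
      by (rule barycentric_map_span[OF F C' g(3,1,2) sub span])
    have "?g x \<in> span (B - {b})" if "x \<in> S" for x
    proof -
      obtain y where y: "y \<in> B - {b}" "x = f y" using \<open>x \<in> S\<close> S(1) by blast
      then have "?g x = y" using gf[of y] B(1) by blast
      then show ?thesis using span_base[OF y(1)] by simp
    qed
    then have "?g (f b) \<in> span (B - {b})" unfolding S(2) by (intro span_sum span_scale)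
    then have "b \<in> span (B - {b})" using gf[of b] b(1) B(1) by (simp add: subset_iff)
    then show False using B(2) b(1) by (auto simp: dependent_def)
  qed
  moreover have "f ` B \<subseteq> coord_space F" "B \<subseteq> coord_space F" using fC B(1) C C' by auto
  ultimately obtain A A' where A: "matrix_over F A" "matrix_over F A'" "A ** A' = mat 1" "A' ** A = mat 1"
    "\<And>x. x \<in> B \<Longrightarrow> A *v x = f x"
    using independent_bij_extends_to_invertible_matrix[OF F B(2), of "f ` B" f] inj_on_imp_bij_betw[OF inj]
    by metis
  have "A *v x = f x" if x: "x \<in> C" for x
  proof -
    obtain S c where S: "finite S" "S \<subseteq> B" "x = (\<Sum>x\<in>S. c x *\<^sub>R x)" "f x = (\<Sum>x\<in>S. c x *\<^sub>R f x)"
      using barycentric_map_span[OF F C f(2,3) B(1) x] x B(3) by blast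
    have "A *v x = (\<Sum>y\<in>S. c y *\<^sub>R (A *v y))"
      by (subst S(3)) (simp add: linear_sum[OF matrix_vector_mul_linear] matrix_vector_mult_scaleR)
    also have "\<dots> = f x" unfolding S(4) using S(2) A(5) by (intro sum.cong) auto
    finally show ?thesis .
  qed
  with A that show thesis by blast
qed

lemma bary_op_translate: "bary_op p (x - a) (y - a) = bary_op p x y - a"
  by (simp add: bary_op_def algebra_simps)

lemma convex_over_translate:
  "convex_over F C \<Longrightarrow> convex_over F ((\<lambda>x. x - a) ` C)"
  by (auto simp: convex_over_def bary_op_translate)

lemma barycentric_isomorphic_imp_automorphism:
  fixes C C' :: "(real^'n) set"
  assumes F: "real_subfield F"
    and C: "C \<subseteq> coord_space F" "convex_over F C"
    and C': "C' \<subseteq> coord_space F" "convex_over F C'"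
    and iso: "barycentric_isomorphic F C C'"
  shows "\<exists>\<psi>. affine_automorphism F \<psi> \<and> \<psi> ` C = C'"
proof -
  obtain f where f: "bij_betw f C C'" "barycentric_map F C f"
    using iso by (auto simp: barycentric_isomorphic_def barycentric_map_def)
  obtain a where a: "a \<in> C" using C(2) by (auto simp: convex_over_def)
  define V where "V = (\<lambda>x. x - a) ` C"
  define V' where "V' = (\<lambda>y. y - f a) ` C'"
  define h where "h v = f (v + a) - f a" for v
  have fa: "f a \<in> C'" using f(1) a by (auto simp: bij_betw_def)
  have "bij_betw h V V'"
    using f(1) by (auto simp: bij_betw_def V_def V'_def h_def inj_on_def image_image)
  moreover have "barycentric_map F V h"
    using f(2) unfolding barycentric_map_def V_def h_def
    by (auto simp: bary_op_translate)
  moreover have "convex_over F V" "convex_over F V'"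
    using C C' by (auto simp: V_def V'_def intro: convex_over_translate)
  moreover have "V \<subseteq> coord_space F" "V' \<subseteq> coord_space F" "0 \<in> V" "h 0 = 0"
    using C(1) C'(1) a fa by (auto simp: V_def V'_def h_def intro!: coord_space_diff[OF F])
  ultimately obtain A A' where A: "matrix_over F A" "matrix_over F A'" "A ** A' = mat 1" "A' ** A = mat 1"
    and Ah: "\<And>x. x \<in> V \<Longrightarrow> A *v x = h x"
    using barycentric_bijection_linear[OF F] by metis
  define b where "b = f a - A *v a"
  have "b \<in> coord_space F"
    unfolding b_def using A a fa C C' by (auto intro!: coord_space_diff[OF F] coord_space_matrix_vector[OF F])
  then have "affine_automorphism F (\<lambda>x. A *v x + b)"
    using A unfolding affine_automorphism_def by blast
  moreover have "A *v x + b = f x" if "x \<in> C" for x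
    using Ah[of "x - a"] that by (auto simp: V_def h_def b_def matrix_vector_mult_diff_distrib algebra_simps)
  then have "(\<lambda>x. A *v x + b) ` C = C'"
    using f(1) by (auto simp: bij_betw_def image_iff)
  ultimately show ?thesis by blast
qed

section \<open>Additive functions on the unit interval of a subfield\<close>

text \<open>If \<open>a / b\<close> is a reduced fraction in \<open>T\<close> and \<open>u * a + v * b = 1\<close>, then
  \<open>u * (a / b) + v = 1 / b\<close>.\<close>

lemma subring_contains_unit_fraction:
  assumes T: "real_subring T" and ne: "\<int> \<subseteq> T \<inter> \<rat>" "\<int> \<noteq> T \<inter> \<rat>"
  obtains m :: nat where "2 \<le> m" "1 / real m \<in> T"
proof -
  obtain q where q: "q \<in> T" "q \<in> \<rat>" "q \<notin> \<int>" using ne by blast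
  obtain a b :: int where ab: "b > 0" "coprime a b" "q = of_int a / of_int b"
    using q(2) by (auto elim: Rats_cases')
  have "b \<noteq> 1" using ab(3) q(3) by auto
  obtain u v where uv: "u * a + v * b = 1"
    using ab(2) bezout_int[of a b] by auto
  have "real_of_int u * q + real_of_int v = real_of_int (u * a + v * b) / of_int b"
    using ab by (simp add: field_simps)
  then have "1 / real_of_int b = real_of_int u * q + real_of_int v" by (simp add: uv)
  also have "\<dots> \<in> T"
  proof -
    have "real_of_int u \<in> T" "real_of_int v \<in> T" using ne(1) by auto
    then show ?thesis using q(1) T by (simp add: real_subring_def)
  qed
  finally have "1 / real (nat b) \<in> T" using ab(1) by simp
  moreover have "2 \<le> nat b" using ab(1) \<open>b \<noteq> 1\<close> by linarith
  ultimately show thesis using that by blast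
qed

text \<open>Taking one argument to be \<open>0\<close> shows that \<open>g\<close> commutes with multiplication by \<open>1 / m\<close> and by
  \<open>1 - 1 / m\<close>. The mean of weight \<open>1 / m\<close> of \<open>s'\<close> and \<open>t\<close> equals \<open>(s + t) / m\<close> when
  \<open>s' = s / (m - 1)\<close>, and \<open>s'\<close> stays in the unit interval because \<open>m \<ge> 2\<close>.\<close>

lemma barycentric_function_additive:
  fixes g :: "real \<Rightarrow> 'a::real_vector" and m :: nat
  assumes F: "real_subfield F" and m: "2 \<le> m" and "g 0 = 0"
    and bary: "\<And>s t. s \<in> F \<inter> {0..1} \<Longrightarrow> t \<in> F \<inter> {0..1} \<Longrightarrow>
      g ((1 - 1 / m) * s + (1 / m) * t) = (1 - 1 / m) *\<^sub>R g s + (1 / m) *\<^sub>R g t"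
    and s: "s \<in> F \<inter> {0..1}" and t: "t \<in> F \<inter> {0..1}" and st: "s + t \<in> F \<inter> {0..1}"
  shows "g (s + t) = g s + g t"
proof -
  have 0: "0 \<in> F \<inter> {0..1}" using subfield_closed[OF F] by simp
  have div: "g (t / m) = (1 / m) *\<^sub>R g t" if "t \<in> F \<inter> {0..1}" for t
    using bary[OF 0 that] \<open>g 0 = 0\<close> by simp
  define s' where "s' = s / (real m - 1)"
  have s': "s' \<in> F \<inter> {0..1}"
    using s m subfield_closed[OF F] by (auto simp: s'_def divide_le_eq)
  have eq: "(1 - 1 / m) * s' = s / m"
    using m by (simp add: s'_def field_simps)
  have "(1 / m) *\<^sub>R g (s + t) = g (s / m + t / m)"
    using div[OF st] by (simp add: add_divide_distrib)
  also have "\<dots> = (1 - 1 / m) *\<^sub>R g s' + (1 / m) *\<^sub>R g t"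
    using bary[OF s' t] by (simp add: eq)
  also have "(1 - 1 / m) *\<^sub>R g s' = g (s / m)"
    using bary[OF s' 0] \<open>g 0 = 0\<close> by (simp add: eq)
  also have "\<dots> = (1 / m) *\<^sub>R g s" using div[OF s] .
  finally show ?thesis using m by (simp flip: scaleR_add_right)
qed

text \<open>Additivity and \<open>g 1 = 0\<close> kill \<open>g\<close> at all rational points. In the bounded case, let \<open>r\<close> be the
  fractional part of \<open>n * t\<close>: since \<open>t\<close> and \<open>r / n\<close> differ by a rational number,
  \<open>n * g t = g r\<close>, so all multiples of \<open>g t\<close> obey the bound for \<open>g\<close>. The decomposition is
  carried out at \<open>t\<close> because \<open>n * t\<close> itself may lie outside the domain.\<close>

lemma additive_on_unit_interval_vanishes:
  fixes g :: "real \<Rightarrow> 'a::real_normed_vector"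
  assumes F: "real_subfield F"
    and add: "\<And>s t. s \<in> F \<inter> {0..1} \<Longrightarrow> t \<in> F \<inter> {0..1} \<Longrightarrow> s + t \<in> F \<inter> {0..1} \<Longrightarrow> g (s + t) = g s + g t"
    and g1: "g 1 = 0" and rigid: "F = \<rat> \<or> bounded (g ` (F \<inter> {0..1}))"
    and t: "t \<in> F \<inter> {0..1}"
  shows "g t = 0"
proof -
  note cl = subfield_closed[OF F]
  have g0: "g 0 = 0" using add[of 0 0] cl by simp
  have mult: "g (real k * t) = real k *\<^sub>R g t" if "t \<in> F \<inter> {0..1}" "real k * t \<le> 1" for k t
    using that
  proof (induction k)
    case 0
    then show ?case using g0 by simp
  next
    case (Suc k)
    have le: "real k * t + t \<le> 1" using Suc.prems by (simp add: algebra_simps)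
    then have k: "real k * t \<le> 1" using Suc.prems by simp
    have "g (real k * t + t) = g (real k * t) + g t"
      using Suc.prems(1) k le by (intro add) (auto simp: cl)
    then show ?case using Suc.IH[OF Suc.prems(1) k] by (simp add: algebra_simps)
  qed
  have frac: "g (real k / real d) = 0" if "k \<le> d" for k d :: nat
  proof (cases "d = 0")
    case False
    have d: "1 / real d \<in> F \<inter> {0..1}" using False by (simp add: cl)
    have "g (1 / real d) = 0" using mult[OF d, of d] False g1 by simp
    then show ?thesis using mult[OF d, of k] that False by simp
  qed (use g0 in simp)
  from rigid show ?thesis
  proof
    assume "F = \<rat>"
    then obtain a b :: int where ab: "b > 0" "t = of_int a / of_int b"
      using t by (auto elim: Rats_cases')
    then have "0 \<le> real_of_int a / of_int b" "real_of_int a / of_int b \<le> 1" using t by auto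
    then have "0 \<le> a" "a \<le> b" using ab(1) by (simp_all add: zero_le_divide_iff divide_le_eq)
    then show ?thesis using frac[of "nat a" "nat b"] ab by simp
  next
    assume "bounded (g ` (F \<inter> {0..1}))"
    then obtain K where K: "\<And>s. s \<in> F \<inter> {0..1} \<Longrightarrow> norm (g s) \<le> K"
      unfolding bounded_iff by blast
    have le: "real n * norm (g t) \<le> K" for n :: nat
    proof (cases "n = 0")
      case True
      have "0 \<le> K" using K[OF t] norm_ge_zero[of "g t"] by linarith
      then show ?thesis using True by simp
    next
      case False
      define k where "k = nat \<lfloor>real n * t\<rfloor>"
      define r where "r = real n * t - real k"
      have k: "real k \<le> real n * t" "real n * t < real k + 1"
        using t by (auto simp: k_def)
      have r: "r \<in> F \<inter> {0..1}" using k t by (auto simp: r_def cl)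
      have "real n * t \<le> real n" using t by (simp add: mult_left_le)
      then have kn: "k \<le> n" using k by linarith
      have rn: "r / real n \<in> F \<inter> {0..1}" using r False by (auto simp: cl divide_le_eq)
      have teq: "t = real k / real n + r / real n" using False by (simp add: r_def field_simps)
      have "g t = g (real k / real n) + g (r / real n)"
        using t rn kn False by (subst teq, intro add) (auto simp: cl teq[symmetric])
      then have "real n *\<^sub>R g t = g r"
        using mult[OF rn, of n] r False frac[OF kn] by simp
      then have "real n * norm (g t) = norm (g r)" by (metis norm_scaleR abs_of_nat)
      then show ?thesis using K[OF r] by simp
    qed
    show ?thesis
    proof (rule ccontr)
      assume "g t \<noteq> 0"
      then obtain n :: nat where "K < real n * norm (g t)"
        using reals_Archimedean3[of "norm (g t)"] by auto
      then show False using le[of n] by simp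
    qed
  qed
qed

section \<open>Rigidity of barycentric isomorphisms\<close>

lemma bary_op_nested:
  "bary_op p (bary_op s x y) (bary_op t x y) = bary_op ((1 - p) * s + p * t) x y"
  by (simp add: bary_op_def algebra_simps)

text \<open>On the segment from \<open>x\<close> to \<open>y\<close> the deviation of \<open>f\<close> from affinity is additive in the parameter
  and zero at the ends, and it is bounded if \<open>f\<close> is.\<close>

lemma barycentric_map_rigid:
  fixes f :: "real^'n \<Rightarrow> real^'n"
  assumes F: "real_subfield F" and T: "real_subring T" "\<int> \<subseteq> T \<inter> \<rat>" "\<int> \<noteq> T \<inter> \<rat>"
    and C: "convex_over F C" and f: "barycentric_map T C f"
    and rigid: "F = \<rat> \<or> bounded (f ` C)"
  shows "barycentric_map F C f"
  unfolding barycentric_map_def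
proof (intro ballI)
  fix p x y assume p: "p \<in> open_unit F" and x: "x \<in> C" and y: "y \<in> C"
  obtain m :: nat where m: "2 \<le> m" "1 / real m \<in> T"
    using subring_contains_unit_fraction[OF T] by blast
  have mT: "1 / real m \<in> open_unit T" using m by (simp add: open_unit_def)
  have inC: "bary_op t x y \<in> C" if t: "t \<in> F \<inter> {0..1}" for t
  proof -
    consider "t = 0" | "t = 1" | "t \<in> open_unit F" using t by (fastforce simp: open_unit_def less_le)
    then show ?thesis
      using C x y by cases (auto simp: convex_over_def bary_op_def)
  qed
  define g where "g t = f (bary_op t x y) - bary_op t (f x) (f y)" for t
  have bary: "g ((1 - 1 / m) * s + (1 / m) * t) = (1 - 1 / m) *\<^sub>R g s + (1 / m) *\<^sub>R g t"
    if s: "s \<in> F \<inter> {0..1}" and t: "t \<in> F \<inter> {0..1}" for s t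
  proof -
    have "f (bary_op (1 / m) (bary_op s x y) (bary_op t x y)) =
        bary_op (1 / m) (f (bary_op s x y)) (f (bary_op t x y))"
      using f mT inC[OF s] inC[OF t] by (simp add: barycentric_map_def)
    then have "g ((1 - 1 / m) * s + (1 / m) * t) =
        bary_op (1 / m) (f (bary_op s x y)) (f (bary_op t x y)) -
        bary_op (1 / m) (bary_op s (f x) (f y)) (bary_op t (f x) (f y))"
      unfolding g_def bary_op_nested by simp
    also have "\<dots> = (1 - 1 / m) *\<^sub>R g s + (1 / m) *\<^sub>R g t"
      unfolding g_def bary_op_def[of "1 / m"] by (simp add: scaleR_diff_right)
    finally show ?thesis .
  qed
  have ends: "g 0 = 0" "g 1 = 0" by (simp_all add: g_def bary_op_def)
  have "F = \<rat> \<or> bounded (g ` (F \<inter> {0..1}))"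
  proof (cases "F = \<rat>")
    case False
    then obtain K where K: "\<And>z. z \<in> C \<Longrightarrow> norm (f z) \<le> K"
      using rigid by (auto simp: bounded_iff)
    have "norm (g t) \<le> K + (norm (f x) + norm (f y))" if t: "t \<in> F \<inter> {0..1}" for t
    proof -
      have "norm ((1 - t) *\<^sub>R f x) \<le> norm (f x)" "norm (t *\<^sub>R f y) \<le> norm (f y)"
        using t by (auto simp: mult_left_le_one_le)
      then have "norm (bary_op t (f x) (f y)) \<le> norm (f x) + norm (f y)"
        using norm_triangle_ineq[of "(1 - t) *\<^sub>R f x" "t *\<^sub>R f y"]
        unfolding bary_op_def by linarith
      then show ?thesis using K[OF inC[OF t]] norm_triangle_ineq4[of "f (bary_op t x y)" "bary_op t (f x) (f y)"]
        unfolding g_def by linarith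
    qed
    then show ?thesis unfolding bounded_iff by blast
  qed simp
  moreover have "g (s + t) = g s + g t"
    if "s \<in> F \<inter> {0..1}" "t \<in> F \<inter> {0..1}" "s + t \<in> F \<inter> {0..1}" for s t
    using barycentric_function_additive[of F m g, OF F m(1) ends(1) bary] that by blast
  ultimately have "g p = 0"
    using p additive_on_unit_interval_vanishes[of F g p] F ends(2) by (auto simp: open_unit_def)
  then show "f (bary_op p x y) = bary_op p (f x) (f y)" by (simp add: g_def)
qed

lemma convex_over_mono: "convex_over F C \<Longrightarrow> T \<subseteq> F \<Longrightarrow> convex_over T C"
  by (auto simp: convex_over_def open_unit_def)

lemma barycentric_isomorphic_rigid:
  fixes C C' :: "(real^'n) set"
  assumes F: "real_subfield F"
    and T: "real_subring T" "\<int> \<subseteq> T \<inter> \<rat>" "\<int> \<noteq> T \<inter> \<rat>" "T \<subseteq> F"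
    and C: "convex_over F C" and C': "convex_over F C'"
    and rigid: "F = \<rat> \<or> bounded C \<or> bounded C'"
    and iso: "barycentric_isomorphic T C C'"
  shows "barycentric_isomorphic F C C'"
proof -
  obtain f where f: "bij_betw f C C'" "barycentric_map T C f"
    using iso by (auto simp: barycentric_isomorphic_def barycentric_map_def)
  have "barycentric_map F C f"
  proof (cases "F = \<rat> \<or> bounded C'")
    case True
    then show ?thesis
      using barycentric_map_rigid[OF F T(1-3) C f(2)] f(1) by (auto simp: bij_betw_def)
  next
    case False
    \<comment> \<open>Here \<open>C\<close> is bounded, so the inverse map has bounded range.\<close>
    let ?g = "inv_into C f"
    have g: "bij_betw ?g C' C" by (rule bij_betw_inv_into[OF f(1)])
    have "barycentric_map T C' ?g"
      using barycentric_map_inverse[OF convex_over_mono[OF C T(4)] f] .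
    moreover have "bounded (?g ` C')" using False rigid g by (simp add: bij_betw_def)
    ultimately have "barycentric_map F C' ?g"
      using barycentric_map_rigid[OF F T(1-3) C'] by blast
    from barycentric_map_inverse[OF C' g this] have "barycentric_map F C (inv_into C' ?g)" .
    moreover have "inv_into C' ?g x = f x" if "x \<in> C" for x
      using that f(1) by (simp add: inv_into_inv_into_eq)
    ultimately show ?thesis using C by (auto simp: barycentric_map_def convex_over_def)
  qed
  with f(1) show ?thesis by (auto simp: barycentric_isomorphic_def barycentric_map_def)
qed

section \<open>Equivalence of the notions of isomorphism\<close>

lemma affine_automorphism_barycentric:
  fixes C C' :: "(real^'n) set"
  assumes "affine_automorphism UNIV \<psi>" "\<psi> ` C = C'"
  shows "barycentric_isomorphic F C C'"
proof -
  obtain A A' b where A: "A' ** A = mat 1" and \<psi>: "\<And>x. \<psi> x = A *v x + b"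
    using assms(1) by (auto simp: affine_automorphism_def coord_space_def)
  have "inj \<psi>"
  proof (rule injI)
    fix x y assume "\<psi> x = \<psi> y"
    then have "A' *v (A *v x) = A' *v (A *v y)" by (simp add: \<psi>)
    then show "x = y" using A by (simp add: matrix_vector_mul_assoc)
  qed
  then have "bij_betw \<psi> C C'" using assms(2) by (auto simp: bij_betw_def intro: inj_on_subset)
  moreover have "\<psi> (bary_op p x y) = bary_op p (\<psi> x) (\<psi> y)" for p x y
    by (simp add: \<psi> bary_op_def matrix_vector_right_distrib matrix_vector_mult_scaleR algebra_simps)
  ultimately show ?thesis by (auto simp: barycentric_isomorphic_def)
qed

lemma affine_automorphism_extend_scalars:
  assumes "affine_automorphism F \<psi>" "\<psi> ` C = C'" "C \<subseteq> coord_space F"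
  shows "\<exists>\<psi>. affine_automorphism UNIV \<psi> \<and> \<psi> ` C = C'"
proof -
  obtain A A' b where A: "A ** A' = mat 1" "A' ** A = mat 1"
    and \<psi>: "\<And>x. x \<in> coord_space F \<Longrightarrow> \<psi> x = A *v x + b"
    using assms(1) by (auto simp: affine_automorphism_def)
  have "affine_automorphism UNIV (\<lambda>x. A *v x + b)"
    using A by (auto simp: affine_automorphism_def matrix_over_def coord_space_def)
  moreover have "(\<lambda>x. A *v x + b) ` C = \<psi> ` C"
    using \<psi> assms(3) by (intro image_cong) auto
  ultimately show ?thesis using assms(2) by auto
qed

theorem theorem2p4:
  fixes F T :: "real set" and C C' :: "(real ^ 'n) set"
  assumes "real_subfield F"
    and "real_subring T" and "T \<subseteq> F"
    and "\<int> \<subseteq> T \<inter> \<rat>" and "\<int> \<noteq> T \<inter> \<rat>"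
    and "C \<subseteq> coord_space F" and "convex_over F C"
    and "C' \<subseteq> coord_space F" and "convex_over F C'"
    and "F = \<rat> \<or> (aff_dim_over F C = aff_dim_over F C' \<and> (bounded C \<or> bounded C'))"
  shows "(barycentric_isomorphic T C C' \<longleftrightarrow> (\<exists>\<psi>. affine_automorphism F \<psi> \<and> \<psi> ` C = C')) \<and>
    ((\<exists>\<psi>. affine_automorphism F \<psi> \<and> \<psi> ` C = C') \<longleftrightarrow>
       (\<exists>\<psi>. affine_automorphism (UNIV :: real set) \<psi> \<and> \<psi> ` C = C'))"
proof -
  let ?over = "\<lambda>K. \<exists>\<psi>. affine_automorphism K \<psi> \<and> \<psi> ` C = C'"
  have "?over F \<Longrightarrow> ?over UNIV"
    using affine_automorphism_extend_scalars assms(6) by blast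
  moreover have "?over UNIV \<Longrightarrow> barycentric_isomorphic S C C'" for S
    using affine_automorphism_barycentric by blast
  moreover have "barycentric_isomorphic T C C' \<Longrightarrow> barycentric_isomorphic F C C'"
    using barycentric_isomorphic_rigid[OF assms(1,2,4,5,3,7,9)] assms(10) by blast
  moreover have "barycentric_isomorphic F C C' \<Longrightarrow> ?over F"
    using barycentric_isomorphic_imp_automorphism[OF assms(1,6-9)] by blast
  ultimately show ?thesis by blast
qed

end
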